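(* Let $n\ge 1$ be an integer and let $f\colon \mathbb{R}\to\mathbb{R}$ be an additive function. Then the mapping $$\mathbb{R}\ni\alpha\longmapsto \delta_{\alpha}^{n+1}f(1)$$ is locally regular if and only if there exists a derivation $d\colon\mathbb{R}\to\mathbb{R}$ of order $n$ such that $$f(x)=d(x)+f(1)\cdot x\qquad\text{for all } x\in\mathbb{R}.$$
   Context: A function $f\colon\mathbb{R}\to\mathbb{R}$ is additive if $f(x+y)=f(x)+f(y)$ for all $x,y\in\mathbb{R}$. For any function $f\colon\mathbb{R}\to\mathbb{R}$ and $\alpha\in\mathbb{R}$, the function $\delta_{\alpha}f\colon\mathbb{R}\to\mathbb{R}$ is defined by $\delta_{\alpha}f(x)=f(\alpha x)-\alpha f(x)$ for $x\in\mathbb{R}$. Compositions $\delta_{\alpha_1}\circ\cdots\circ\delta_{\alpha_m}f$ denote successive application of these operators to $f$; $\delta_{\alpha}^{n+1}f$ is the result of applying $\delta_\alpha$ to $f$ a total of $n+1$ times, and $\delta_{\alpha}^{n+1}f(1)$ is its value at the point $1$. An additive function $d\colon\mathbb{R}\to\mathbb{R}$ is a derivation of order $n$ if $d(1)=0$ and $\delta_{\alpha_1}\circ\cdots\circ\delta_{\alpha_{n+1}}d(x)=0$ for all $x,\alpha_1,\ldots,\alpha_{n+1}\in\mathbb{R}$. A real-valued function is locally regular on its domain if at least one of the following holds: (i) it is bounded on a (Lebesgue) measurable set of positive measure; (ii) it is continuous at a point; (iii) there exists a set of positive Lebesgue measure such that the restriction of the function to this set is Lebesgue measurable. *)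

theory Defs
  imports "HOL-Analysis.Analysis"
begin

definition delta :: "real \<Rightarrow> (real \<Rightarrow> real) \<Rightarrow> real \<Rightarrow> real" where
  "delta \<alpha> f = (\<lambda>x. f (\<alpha> * x) - \<alpha> * f x)"

text \<open>For a list \<open>as = [\<alpha>\<^sub>1, \<dots>, \<alpha>\<^sub>m]\<close>, \<open>foldr delta as d\<close> is
  \<open>delta \<alpha>\<^sub>1 (\<dots> (delta \<alpha>\<^sub>m d) \<dots>)\<close>. \<open>Modules.additive\<close> is Cauchy additivity;
  the qualifier avoids the unrelated measure-theoretic \<open>additive\<close>.\<close>

definition derivation_of_order :: "nat \<Rightarrow> (real \<Rightarrow> real) \<Rightarrow> bool" where
  "derivation_of_order n d \<longleftrightarrow>
     Modules.additive d \<and> d 1 = 0 \<and>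
     (\<forall>as x. length as = n + 1 \<longrightarrow> foldr delta as d x = 0)"

definition locally_regular :: "(real \<Rightarrow> real) \<Rightarrow> bool" where
  "locally_regular f \<longleftrightarrow>
     (\<exists>A \<in> sets lebesgue. emeasure lebesgue A > 0 \<and> bounded (f ` A)) \<or>
     (\<exists>x. isCont f x) \<or>
     (\<exists>A \<in> sets lebesgue. emeasure lebesgue A > 0 \<and> f \<in> borel_measurable (lebesgue_on A))"

end

theory Submission
  imports Defs "HOL-Computational_Algebra.Polynomial"
begin

text \<open>Write \<open>P x = \<delta>\<^bsub>x\<^esub>\<^sup>N f 1\<close> with \<open>N = n + 1\<close>. A set of positive measure contains
  \<open>x, x + h, \<dots>, x + N h\<close> for all small \<open>h\<close>, and \<open>P (x + t h)\<close> is for rational \<open>t\<close> a polynomial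
  of degree at most \<open>N\<close> whose coefficient of \<open>t\<^sup>N\<close> is \<open>P h\<close>; so a locally regular \<open>P\<close> is bounded
  near \<open>0\<close>. As \<open>\<delta>\<^bsub>q\<^esub>\<close> kills additive functions for rational \<open>q\<close>, \<open>P\<close> is \<open>\<rat>\<close>-periodic, hence bounded,
  and homogeneity forces \<open>P = 0\<close>. Polarization then annihilates all mixed compositions at \<open>1\<close>,
  so every composition of \<open>n\<close> operators turns \<open>f\<close> into a linear function.\<close>

section \<open>Algebra of \<open>delta\<close> and polynomial dependence on its parameter\<close>

lemma additive_of_rat:
  fixes g :: "real \<Rightarrow> real"
  assumes "Modules.additive g" and "q \<in> \<rat>"
  shows "g (q * x) = q * g x"
proof -
  interpret additive g by fact
  have nat: "g (real k * y) = real k * g y" for k y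
    by (induction k) (simp_all add: zero add algebra_simps)
  have int: "g (real_of_int i * y) = real_of_int i * g y" for i y
    by (cases i rule: int_cases2) (simp_all add: nat minus)
  obtain i :: int and k :: nat where q: "q = i / k" "k \<noteq> 0"
    using \<open>q \<in> \<rat>\<close> by (auto simp: Rats_eq_int_div_nat)
  have "real k * g (q * x) = g (real_of_int i * x)"
    using q by (simp add: nat[symmetric])
  also have "\<dots> = real k * (q * g x)"
    using q by (simp add: int)
  finally show ?thesis using q(2) by simp
qed

lemma delta_additive:
  assumes "Modules.additive g"
  shows "Modules.additive (delta a g)"
  using assms by (simp add: Modules.additive_def delta_def algebra_simps)

lemma funpow_delta_additive:
  "Modules.additive g \<Longrightarrow> Modules.additive ((delta a ^^ m) g)"
  by (induction m) (simp_all add: delta_additive)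

lemma delta_commute: "delta a (delta b g) = delta b (delta a g)"
  by (simp add: delta_def fun_eq_iff algebra_simps)

lemma delta_add_left:
  assumes "Modules.additive g"
  shows "delta (a + b) g = (\<lambda>x. delta a g x + delta b g x)"
  using assms by (simp add: Modules.additive_def delta_def fun_eq_iff algebra_simps)

lemma delta_rat:
  assumes "Modules.additive g" and "q \<in> \<rat>"
  shows "delta q g = (\<lambda>x. 0)"
  using additive_of_rat[OF assms] by (simp add: delta_def fun_eq_iff)

lemma delta_rat_mult_left:
  assumes "Modules.additive g" and "q \<in> \<rat>"
  shows "delta (q * a) g = (\<lambda>x. q * delta a g x)"
  using additive_of_rat[OF assms] by (simp add: delta_def fun_eq_iff mult.assoc right_diff_distrib)

lemma delta_add_rat:
  assumes "Modules.additive g" and "q \<in> \<rat>"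
  shows "delta (a + q) g = delta a g"
  using assms by (simp add: delta_add_left delta_rat)

lemma funpow_delta_add:
  "(delta a ^^ m) (\<lambda>x. g x + c * h x) z = (delta a ^^ m) g z + c * (delta a ^^ m) h z"
  by (induction m arbitrary: z) (simp_all add: delta_def algebra_simps)

lemma funpow_delta_scale:
  "(delta a ^^ m) (\<lambda>x. c * h x) z = c * (delta a ^^ m) h z"
  by (induction m arbitrary: z) (simp_all add: delta_def algebra_simps)

lemma funpow_delta_add_rat:
  assumes "Modules.additive g" and "q \<in> \<rat>"
  shows "(delta (a + q) ^^ m) g = (delta a ^^ m) g"
  using assms by (induction m) (simp_all add: delta_add_rat funpow_delta_additive)

lemma funpow_delta_rat_mult:
  assumes "Modules.additive g" and "q \<in> \<rat>"
  shows "(delta (q * a) ^^ m) g z = q ^ m * (delta a ^^ m) g z"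
  using assms(1)
proof (induction m arbitrary: g)
  case (Suc m)
  have "(delta (q * a) ^^ Suc m) g z = q * (delta (q * a) ^^ m) (delta a g) z"
    by (simp only: funpow_Suc_right o_apply delta_rat_mult_left[OF Suc.prems assms(2)] funpow_delta_scale)
  also have "\<dots> = q ^ Suc m * (delta a ^^ Suc m) g z"
    using Suc.IH[OF delta_additive[OF Suc.prems]] by (simp add: funpow_Suc_right del: funpow.simps(2))
  finally show ?case .
qed simp

text \<open>The coefficient of \<open>t\<^sup>m\<close> transfers bounds at \<open>x + j h\<close> to \<open>h\<close>; that of \<open>t\<close> drives the
  polarization.\<close>

lemma funpow_delta_poly:
  fixes x h z :: real
  assumes "Modules.additive g"
  shows "\<exists>p. degree p \<le> m \<and> coeff p m = (delta h ^^ m) g z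
    \<and> coeff p 1 = real m * (delta x ^^ (m - 1)) (delta h g) z
    \<and> (\<forall>t\<in>\<rat>. poly p t = (delta (x + t * h) ^^ m) g z)"
  using assms
proof (induction m arbitrary: g)
  case 0
  show ?case
    by (rule exI[of _ "[:g z:]"]) simp
next
  case (Suc m)
  \<comment> \<open>Since \<open>delta (x + t * h) g\<close> is \<open>delta x g\<close> plus
    \<open>t\<close> times \<open>delta h g\<close>, the induction hypothesis at these two functions
    gives \<open>p\<close> and \<open>r\<close>, and the polynomial sought is
    \<open>p + pCons 0 r\<close>, that is, p(t) + t r(t).\<close>
  obtain p where p: "degree p \<le> m" "coeff p m = (delta h ^^ m) (delta x g) z"
      "coeff p 1 = real m * (delta x ^^ (m - 1)) (delta h (delta x g)) z"
      "\<And>t. t \<in> \<rat> \<Longrightarrow> poly p t = (delta (x + t * h) ^^ m) (delta x g) z"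
    using Suc.IH[OF delta_additive[OF Suc.prems]] by blast
  obtain r where r: "degree r \<le> m" "coeff r m = (delta h ^^ m) (delta h g) z"
      "\<And>t. t \<in> \<rat> \<Longrightarrow> poly r t = (delta (x + t * h) ^^ m) (delta h g) z"
    using Suc.IH[OF delta_additive[OF Suc.prems]] by blast
  \<comment> \<open>For \<open>m = 0\<close> the truncated exponent \<open>m - 1\<close> is
    harmless, as the factor \<open>real m\<close> makes both sides zero.\<close>
  have "real m * (delta x ^^ (m - 1)) (delta h (delta x g)) z = real m * (delta x ^^ m) (delta h g) z"
    by (cases m) (simp_all add: delta_commute[of h x] funpow_Suc_right del: funpow.simps(2))
  moreover have "coeff r 0 = (delta x ^^ m) (delta h g) z"
    using r(3)[of 0] by (simp add: poly_0_coeff_0)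
  ultimately have "coeff (p + pCons 0 r) 1 = real (Suc m) * (delta x ^^ (Suc m - 1)) (delta h g) z"
    using p(3) by (simp add: algebra_simps)
  moreover have "degree (p + pCons 0 r) \<le> Suc m"
    using p(1) r(1) by (intro degree_add_le) (auto intro: order.trans[OF degree_pCons_le])
  moreover have "coeff (p + pCons 0 r) (Suc m) = (delta h ^^ Suc m) g z"
    using p(1) r(2) by (simp add: coeff_eq_0 funpow_Suc_right del: funpow.simps(2))
  moreover have "poly (p + pCons 0 r) t = (delta (x + t * h) ^^ Suc m) g z" if "t \<in> \<rat>" for t
    using p(4)[OF that] r(3)[OF that]
    by (simp add: funpow_Suc_right delta_add_left[OF Suc.prems]
        delta_rat_mult_left[OF Suc.prems that] funpow_delta_add del: funpow.simps(2))
  ultimately show ?case by blast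
qed

section \<open>Coefficient bounds, polarization and rational scaling\<close>

text \<open>Dividing by the linear factor of the last node keeps the leading coefficient and lowers
  the degree. The nodes are at distance at least 1 from each other, so the quotient is bounded by
  \<open>2 * M\<close> at the remaining ones; each of the \<open>m\<close> divisions costs a factor
  2.\<close>

lemma coeff_bound_of_values:
  fixes p :: "real poly"
  assumes "degree p \<le> m" and "\<And>j. j \<le> m \<Longrightarrow> \<bar>poly p (real j)\<bar> \<le> M"
  shows "\<bar>coeff p m\<bar> \<le> 2 ^ m * M"
  using assms
proof (induction m arbitrary: p M)
  case 0
  then show ?case
    by (metis abs_mult abs_one le_zero_eq lambda_one of_nat_0 poly_0_coeff_0 power_0)
next
  case (Suc m)
  define c where "c = real (Suc m)"
  define s where "s = synthetic_div p c"
  have eq: "p + smult c s = pCons (poly p c) s"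
    unfolding s_def by (rule synthetic_div_correct)
  have deg: "degree s \<le> m"
    using Suc.prems(1) by (simp add: s_def degree_synthetic_div)
  have "coeff (p + smult c s) (Suc m) = coeff s m"
    by (simp add: eq)
  then have coeff: "coeff p (Suc m) = coeff s m"
    using deg by (simp add: coeff_eq_0)
  have "\<bar>poly s (real j)\<bar> \<le> 2 * M" if "j \<le> m" for j
  proof -
    have "poly p j + c * poly s j = poly p c + j * poly s j"
      using arg_cong[OF eq, of "\<lambda>q. poly q (real j)"] by simp
    then have "(c - j) * poly s j = poly p c - poly p j"
      by (simp add: algebra_simps)
    then have "\<bar>c - j\<bar> * \<bar>poly s j\<bar> = \<bar>poly p c - poly p j\<bar>"
      by (metis abs_mult)
    also have "\<dots> \<le> 2 * M"
      using Suc.prems(2)[of j] Suc.prems(2)[of "Suc m"] that unfolding c_def by linarith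
    finally have "\<bar>c - j\<bar> * \<bar>poly s j\<bar> \<le> 2 * M" .
    moreover have "1 * \<bar>poly s j\<bar> \<le> \<bar>c - j\<bar> * \<bar>poly s j\<bar>"
      using that by (intro mult_right_mono) (auto simp: c_def)
    ultimately show ?thesis by linarith
  qed
  from Suc.IH[OF deg this] show ?case
    by (simp add: coeff algebra_simps)
qed

text \<open>Polarization, one operator at a time. The diagonal at \<open>x + t * a\<close> is a
  polynomial in rational \<open>t\<close> with infinitely many zeros, so its linear coefficient
  vanishes. This is the diagonal hypothesis for \<open>delta a g\<close> with one operator
  fewer.\<close>

lemma foldr_delta_eq_0_of_diagonal:
  assumes "Modules.additive g" and "\<And>x. (delta x ^^ length as) g z = 0"
  shows "foldr delta as g z = 0"
  using assms
proof (induction as arbitrary: g rule: rev_induct)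
  case (snoc a as)
  have "(delta x ^^ length as) (delta a g) z = 0" for x
  proof -
    obtain p where p: "coeff p 1 = real (Suc (length as)) * (delta x ^^ length as) (delta a g) z"
      "\<forall>t\<in>\<rat>. poly p t = (delta (x + t * a) ^^ Suc (length as)) g z"
      using funpow_delta_poly[OF snoc.prems(1), of "Suc (length as)" a z x] by auto
    have "\<rat> \<subseteq> {t. poly p t = 0}"
      using p(2) snoc.prems(2) by auto
    then have "p = 0"
      using poly_roots_finite finite_subset Rats_infinite by blast
    then show ?thesis using p(1) by simp
  qed
  then show ?case
    using snoc.IH[OF delta_additive[OF snoc.prems(1)]] by simp
qed simp

text \<open>Replacing \<open>a\<close> by \<open>k * a\<close> multiplies the value by
  \<open>k ^ m\<close>, while a rational shift brings \<open>k * a\<close> close to 0 without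
  changing it. Hence one bound serves for every \<open>k\<close>.\<close>

lemma bounded_near_0_imp_diagonal_eq_0:
  assumes g: "Modules.additive g" and "m > 0" and "\<epsilon> > 0"
    and bound: "\<And>h. \<bar>h\<bar> < \<epsilon> \<Longrightarrow> \<bar>(delta h ^^ m) g z\<bar> \<le> M"
  shows "(delta a ^^ m) g z = 0"
proof (rule ccontr)
  let ?P = "\<lambda>x. (delta x ^^ m) g z"
  assume "?P a \<noteq> 0"
  then obtain k :: nat where k: "M < real k * \<bar>?P a\<bar>"
    by (metis reals_Archimedean3 zero_less_abs_iff)
  obtain q where q: "q \<in> \<rat>" "real k * a - \<epsilon> < q" "q < real k * a"
    using Rats_dense_in_real[of "real k * a - \<epsilon>" "real k * a"] \<open>\<epsilon> > 0\<close> by auto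
  have "?P (real k * a + - q) = real k ^ m * ?P a"
    using q(1) g by (subst funpow_delta_add_rat) (auto simp: funpow_delta_rat_mult)
  moreover have "\<bar>real k * a + - q\<bar> < \<epsilon>" using q by auto
  ultimately have "real k ^ m * \<bar>?P a\<bar> \<le> M"
    using bound by (metis abs_mult abs_of_nat power_abs)
  moreover have "real k \<le> real k ^ m"
    using \<open>m > 0\<close> by (cases "k = 0") (auto intro: self_le_power)
  ultimately show False
    using k mult_right_mono[of "real k" "real k ^ m" "\<bar>?P a\<bar>"] by auto
qed

section \<open>Sets of positive measure and local regularity\<close>

text \<open>A Steinhaus argument: \<open>m + 1\<close> small translates of a compact
  \<open>K\<close> inside an open set of barely larger measure must have a common point.\<close>

lemma positive_measure_contains_progressions:
  fixes A :: "real set"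
  assumes A: "A \<in> sets lebesgue" and pos: "emeasure lebesgue A > 0"
  obtains \<epsilon> where "\<epsilon> > 0" "\<And>h. \<bar>h\<bar> < \<epsilon> \<Longrightarrow> \<exists>x. \<forall>j\<le>m. x + real j * h \<in> A"
proof -
  let ?\<mu> = "measure lebesgue"
  obtain K where K: "compact K" "K \<subseteq> A" "?\<mu> K > 0"
  proof -
    \<comment> \<open>Cutting with a ball makes the measure finite, and makes the closed inner
      approximation compact.\<close>
    have "\<exists>i. emeasure lebesgue (A \<inter> cball 0 (real i)) \<noteq> 0"
    proof (rule ccontr)
      assume "\<not> ?thesis"
      then have "A \<inter> cball 0 (real i) \<in> null_sets lebesgue" for i
        using A by (intro null_setsI sets.Int) auto
      then have "(\<Union>i. A \<inter> cball 0 (real i)) \<in> null_sets lebesgue"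
        by (rule null_sets_UN)
      moreover have "(\<Union>i. A \<inter> cball 0 (real i)) = A"
        by (auto simp: real_arch_simple)
      ultimately show False using pos by auto
    qed
    then obtain i where i: "emeasure lebesgue (A \<inter> cball 0 (real i)) \<noteq> 0" ..
    define B where "B = A \<inter> cball 0 (real i)"
    have B: "B \<in> lmeasurable"
      unfolding B_def using A fmeasurable_Int_fmeasurable[OF lmeasurable_cball A] by (simp add: Int_commute)
    have "?\<mu> B > 0"
      using i B unfolding B_def[symmetric]
      by (metis emeasure_eq_measure2 ennreal_0 zero_less_measure_iff)
    then obtain C where C: "closed C" "C \<subseteq> B" "B - C \<in> lmeasurable"
      "emeasure lebesgue (B - C) < ennreal (?\<mu> B)"
      using sets_lebesgue_inner_closed[of B "?\<mu> B"] B by (metis fmeasurableD)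
    have "compact C"
      using C(1,2) by (metis B_def Int_lower2 bounded_cball bounded_subset compact_eq_bounded_closed subset_trans)
    moreover have "?\<mu> C > 0"
    proof -
      have "?\<mu> (B - C) < ?\<mu> B"
        using C(3,4) by (simp add: emeasure_eq_measure2 ennreal_less_iff)
      moreover have "?\<mu> (B - C) = ?\<mu> B - ?\<mu> C"
        using B C(2) \<open>compact C\<close> by (intro measurable_measure_Diff) (auto simp: lmeasurable_compact fmeasurableD)
      ultimately show ?thesis by simp
    qed
    ultimately show ?thesis using that C(2) unfolding B_def by blast
  qed
  have Km: "K \<in> lmeasurable" using K(1) by (rule lmeasurable_compact)
  \<comment> \<open>With this \<open>e\<close>, any \<open>m + 1\<close> sets of measure below
    \<open>e\<close> have total measure below that of \<open>K\<close>, so they cannot cover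
    \<open>U\<close>.\<close>
  define e where "e = ?\<mu> K / real (Suc m)"
  have e: "e > 0" using K(3) by (simp add: e_def)
  obtain U where U: "open U" "K \<subseteq> U" "U - K \<in> lmeasurable" "emeasure lebesgue (U - K) < ennreal e"
    using sets_lebesgue_outer_open[of K e] Km e by (metis fmeasurableD)
  have Um: "U \<in> lmeasurable"
    using fmeasurable.Un[OF U(3) Km] U(2) by (simp add: Un_absorb2)
  have UK: "?\<mu> U - ?\<mu> K < e"
  proof -
    have "?\<mu> (U - K) < e"
      using U(3,4) by (simp add: emeasure_eq_measure2 ennreal_less_iff)
    then show ?thesis
      using U(2) Um Km by (simp add: measurable_measure_Diff fmeasurableD)
  qed
  obtain \<delta> where \<delta>: "\<delta> > 0" "(\<Union>x\<in>K. ball x \<delta>) \<subseteq> U"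
    using compact_subset_open_imp_ball_epsilon_subset[OF K(1) U(1,2)] .
  have "\<exists>x. \<forall>j\<le>m. x + real j * h \<in> A" if h: "\<bar>h\<bar> < \<delta> / real (Suc m)" for h
  proof (rule ccontr)
    assume no: "\<not> ?thesis"
    \<comment> \<open>A point of every \<open>T j\<close> with \<open>j \<le> m\<close> would start
      a progression in \<open>K\<close>. If there is none, the sets \<open>U - T j\<close> cover
      \<open>U\<close>.\<close>
    define T where "T j = (\<lambda>x. - (real j * h) + x) ` K" for j
    have TU: "T j \<subseteq> U" if "j \<le> m" for j
    proof -
      have "real j * \<bar>h\<bar> \<le> real (Suc m) * \<bar>h\<bar>"
        using that by (intro mult_right_mono) auto
      then have "\<bar>real j * h\<bar> < \<delta>"
        using h by (simp add: abs_mult field_simps)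
      then have "- (real j * h) + x \<in> ball x \<delta>" for x
        by (simp add: dist_real_def)
      then show ?thesis using \<delta>(2) unfolding T_def by blast
    qed
    have Tm: "T j \<in> lmeasurable" "?\<mu> (T j) = ?\<mu> K" for j
      unfolding T_def by (rule measurable_translation[OF Km], rule measure_translation)
    have "U \<subseteq> (\<Union>j\<in>{..m}. U - T j)"
    proof
      fix x assume "x \<in> U"
      obtain j where "j \<le> m" "x + real j * h \<notin> A" using no by blast
      then have "x \<notin> T j" using K(2) by (auto simp: T_def)
      then show "x \<in> (\<Union>j\<in>{..m}. U - T j)" using \<open>x \<in> U\<close> \<open>j \<le> m\<close> by auto
    qed
    then have "?\<mu> U \<le> ?\<mu> (\<Union>j\<in>{..m}. U - T j)"
      using Um Tm by (intro measure_mono_fmeasurable) (auto intro!: fmeasurable.finite_UN fmeasurable.Diff)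
    also have "\<dots> \<le> (\<Sum>j\<in>{..m}. ?\<mu> (U - T j))"
      using Um Tm by (intro measure_UNION_le) (auto intro!: fmeasurableD fmeasurable.Diff)
    also have "\<dots> = (\<Sum>j\<in>{..m}. ?\<mu> U - ?\<mu> K)"
      using Um Tm TU by (intro sum.cong refl) (simp add: measurable_measure_Diff fmeasurableD)
    also have "\<dots> = real (Suc m) * (?\<mu> U - ?\<mu> K)" by simp
    also have "\<dots> < real (Suc m) * e" using UK by (intro mult_strict_left_mono) auto
    also have "\<dots> = ?\<mu> K" by (simp add: e_def)
    also have "\<dots> \<le> ?\<mu> U" using U(2) Um Km by (intro measure_mono_fmeasurable) (auto simp: fmeasurableD)
    finally show False by simp
  qed
  then show ?thesis using that[of "\<delta> / real (Suc m)"] \<delta>(1) by simp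
qed

text \<open>A function continuous at a point is bounded on a ball around it. A function measurable
  on \<open>A\<close> has measurable sublevel sets \<open>B i\<close> that exhaust \<open>A\<close>,
  so one of them has positive measure.\<close>

lemma locally_regular_imp_bounded:
  assumes "locally_regular P"
  obtains A where "A \<in> sets lebesgue" "emeasure lebesgue A > 0" "bounded (P ` A)"
proof -
  consider (bounded) "\<exists>A \<in> sets lebesgue. emeasure lebesgue A > 0 \<and> bounded (P ` A)"
    | (cont) x where "isCont P x"
    | (meas) A where "A \<in> sets lebesgue" "emeasure lebesgue A > 0" "P \<in> borel_measurable (lebesgue_on A)"
    using assms unfolding locally_regular_def by blast
  then show ?thesis
  proof cases
    case bounded
    then show ?thesis using that by blast
  next
    case cont
    then obtain d where d: "d > 0" "\<And>y. dist y x < d \<Longrightarrow> dist (P y) (P x) < 1"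
      unfolding continuous_at_eps_delta by (metis zero_less_one)
    have "P ` ball x d \<subseteq> ball (P x) 1"
      using d(2) by (auto simp: dist_commute)
    then have "bounded (P ` ball x d)"
      using bounded_ball bounded_subset by blast
    moreover have "emeasure lebesgue (ball x d) > 0"
      using d(1) by (simp add: ball_eq_greaterThanLessThan)
    ultimately show ?thesis using that[of "ball x d"] by simp
  next
    case meas
    define B where "B i = {x \<in> A. \<bar>P x\<bar> \<le> real i}" for i
    have B: "B i \<in> sets lebesgue" for i
    proof -
      have "{x \<in> space (lebesgue_on A). \<bar>P x\<bar> \<le> real i} \<in> sets (lebesgue_on A)"
        using meas(3) by measurable
      moreover have "{x \<in> space (lebesgue_on A). \<bar>P x\<bar> \<le> real i} = B i"
        by (auto simp: B_def)
      ultimately show ?thesis using meas(1) by (simp add: sets_restrict_space_iff)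
    qed
    have "\<exists>i. emeasure lebesgue (B i) \<noteq> 0"
    proof (rule ccontr)
      assume "\<not> ?thesis"
      then have "(\<Union>i. B i) \<in> null_sets lebesgue"
        using B by (intro null_sets_UN) auto
      moreover have "(\<Union>i. B i) = A"
        by (auto simp: B_def real_arch_simple)
      ultimately show False using meas(2) by auto
    qed
    then obtain i where "emeasure lebesgue (B i) > 0"
      by (auto simp: zero_less_iff_neq_zero)
    moreover have "bounded (P ` B i)"
      unfolding bounded_iff by (rule exI[of _ "real i"]) (auto simp: B_def)
    ultimately show ?thesis using that B by blast
  qed
qed

section \<open>Vanishing of the diagonal and the equivalence\<close>

lemma diagonal_eq_0_of_locally_regular:
  assumes g: "Modules.additive g" and "m > 0"
    and reg: "locally_regular (\<lambda>a. (delta a ^^ m) g z)"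
  shows "(delta a ^^ m) g z = 0"
proof -
  let ?P = "\<lambda>a. (delta a ^^ m) g z"
  obtain A where A: "A \<in> sets lebesgue" "emeasure lebesgue A > 0" "bounded (?P ` A)"
    using locally_regular_imp_bounded[OF reg] .
  obtain M where M: "\<And>x. x \<in> A \<Longrightarrow> \<bar>?P x\<bar> \<le> M"
    using A(3) unfolding bounded_iff by auto
  obtain \<epsilon> where \<epsilon>: "\<epsilon> > 0" "\<And>h. \<bar>h\<bar> < \<epsilon> \<Longrightarrow> \<exists>x. \<forall>j\<le>m. x + real j * h \<in> A"
    using positive_measure_contains_progressions[OF A(1,2)] by blast
  have "\<bar>?P h\<bar> \<le> 2 ^ m * M" if h: "\<bar>h\<bar> < \<epsilon>" for h
  proof -
    obtain x where x: "\<And>j. j \<le> m \<Longrightarrow> x + real j * h \<in> A" using \<epsilon>(2)[OF h] by blast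
    obtain p where p: "degree p \<le> m" "coeff p m = ?P h"
      "\<forall>t\<in>\<rat>. poly p t = ?P (x + t * h)"
      using funpow_delta_poly[OF g, of m h z x] by blast
    have "\<bar>poly p (real j)\<bar> \<le> M" if "j \<le> m" for j
      using p(3) M[OF x[OF that]] by simp
    from coeff_bound_of_values[OF p(1) this] show ?thesis by (simp add: p(2))
  qed
  from bounded_near_0_imp_diagonal_eq_0[OF g \<open>m > 0\<close> \<epsilon>(1) this] show ?thesis .
qed

text \<open>The point 1 suffices because the outermost parameter is free: if
  \<open>delta b G\<close> vanishes at 1 for all \<open>b\<close>, then
  \<open>G b = b * G 1\<close>, and a linear \<open>G\<close> is killed by every
  \<open>delta a\<close>. Here \<open>G\<close> is the composition of the other \<open>n\<close>
  operators applied to \<open>d\<close>.\<close>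

lemma derivation_of_order_of_diagonal:
  assumes d: "Modules.additive d" "d 1 = 0"
    and diag: "\<And>a. (delta a ^^ (n + 1)) d 1 = 0"
  shows "derivation_of_order n d"
  unfolding derivation_of_order_def
proof (intro conjI allI impI)
  fix as :: "real list" and x :: real
  assume "length as = n + 1"
  then obtain a bs where as: "as = a # bs" "length bs = n" by (cases as) auto
  have "foldr delta (b # bs) d 1 = 0" for b
    by (rule foldr_delta_eq_0_of_diagonal[OF d(1)]) (use as diag in simp)
  then have lin: "foldr delta bs d b = b * foldr delta bs d 1" for b
    unfolding foldr.simps o_apply delta_def mult_1_right right_minus_eq .
  have "foldr delta as d x = foldr delta bs d (a * x) - a * foldr delta bs d x"
    by (simp add: as delta_def)
  also have "\<dots> = 0"
    by (subst (1 2) lin) simp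
  finally show "foldr delta as d x = 0" .
qed (use d in auto)

text \<open>The innermost \<open>delta a\<close> already kills the linear term, so the exponent has
  to be at least 1.\<close>

lemma funpow_delta_eq_of_linear_diff:
  assumes "\<And>x. f x = d x + c * x"
  shows "(delta a ^^ Suc n) f = (delta a ^^ Suc n) d"
proof -
  have "delta a f = delta a d"
    by (simp add: delta_def fun_eq_iff assms algebra_simps)
  then show ?thesis by (simp add: funpow_Suc_right del: funpow.simps(2))
qed

theorem theorem2p1:
  fixes n :: nat and f :: "real \<Rightarrow> real"
  assumes "n \<ge> 1" and "Modules.additive f"
  shows "locally_regular (\<lambda>\<alpha>. (delta \<alpha> ^^ (n + 1)) f 1) \<longleftrightarrow>
    (\<exists>d. derivation_of_order n d \<and> (\<forall>x. f x = d x + f 1 * x))"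
proof
  assume reg: "locally_regular (\<lambda>\<alpha>. (delta \<alpha> ^^ (n + 1)) f 1)"
  define d where "d x = f x - f 1 * x" for x
  have f: "f x = d x + f 1 * x" for x by (simp add: d_def)
  have "Modules.additive d"
    using assms(2) by (simp add: Modules.additive_def d_def algebra_simps)
  moreover have "(delta a ^^ (n + 1)) d 1 = 0" for a
    using diagonal_eq_0_of_locally_regular[OF assms(2) _ reg]
      funpow_delta_eq_of_linear_diff[OF f, where n = n] by simp
  ultimately have "derivation_of_order n d"
    by (intro derivation_of_order_of_diagonal) (auto simp: d_def)
  with f show "\<exists>d. derivation_of_order n d \<and> (\<forall>x. f x = d x + f 1 * x)" by blast
next
  assume "\<exists>d. derivation_of_order n d \<and> (\<forall>x. f x = d x + f 1 * x)"
  then obtain d where d: "derivation_of_order n d" and f: "\<And>x. f x = d x + f 1 * x" by blast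
  have "(delta a ^^ (n + 1)) f 1 = 0" for a
  proof -
    \<comment> \<open>The diagonal is the composition along a constant list, which the definition of
      a derivation of order \<open>n\<close> covers.\<close>
    have "(delta a ^^ (n + 1)) f 1 = foldr delta (replicate (n + 1) a) d 1"
      using funpow_delta_eq_of_linear_diff[OF f, where n = n and a = a]
      by (simp add: foldr_replicate)
    also have "\<dots> = 0" using d unfolding derivation_of_order_def by (metis length_replicate)
    finally show ?thesis .
  qed
  \<comment> \<open>The mapping is identically zero, hence continuous at every point.\<close>
  then show "locally_regular (\<lambda>\<alpha>. (delta \<alpha> ^^ (n + 1)) f 1)"
    unfolding locally_regular_def by simp
qed

end
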